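(* Let $R$ and $S$ be 2-torsion free rings with identity, let $M$ be a unitary $(R,S)$-bimodule, and let $T=\begin{pmatrix}R&M\\0&S\end{pmatrix}$ be the corresponding upper triangular matrix ring, regarded as a superring. Let $d_0$ and $d_1$ be, respectively, Jordan superderivations of degree $0$ and degree $1$ of $T$. Then there are Jordan derivations $\delta_1$ of $R$ and $\delta_2$ of $S$, an additive mapping $g:M\to M$ such that $$g(rm+ms)=rg(m)+\delta_1(r)m+g(m)s+m\delta_2(s)\qquad (r\in R,\ m\in M,\ s\in S),$$ and an element $m^*\in M$ such that, for every $X=\begin{pmatrix}r&m\\0&s\end{pmatrix}\in T$, $$d_0(X)=\begin{pmatrix}\delta_1(r)&g(m)\\0&\delta_2(s)\end{pmatrix},\qquad d_1(X)=\begin{pmatrix}0&rm^*-m^*s\\0&0\end{pmatrix}.$$ In particular, every Jordan superderivation of $T$ is a Jordan derivation of $T$.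
   Context: All rings are unital. In a ring, $x\circ y=xy+yx$. An additive map $d:A\to A$ on a ring $A$ is a Jordan derivation of $A$ if $d(a\circ b)=d(a)\circ b+a\circ d(b)$ for all $a,b\in A$. A superring is a ring $A$ with identity with additive subgroups $A_0,A_1$ such that $A=A_0\oplus A_1$ and $A_iA_j\subseteq A_{i+j}$ (indices modulo 2). For $a\in A_i$ write $|a|=i$. For $x,y\in A_0\cup A_1$ the Jordan superproduct is $x\circ_s y=xy+(-1)^{|x||y|}yx$. For $i\in\{0,1\}$, a Jordan superderivation of degree $i$ of $A$ is an additive map $d_i:A\to A$ with $d_i(A_j)\subseteq A_{i+j}$ (indices modulo 2) and $d_i(x\circ_s y)=d_i(x)\circ_s y+(-1)^{i|x|}x\circ_s d_i(y)$ for all $x,y\in A_0\cup A_1$. A Jordan superderivation of $A$ is the sum of a Jordan superderivation of degree $0$ and one of degree $1$. $T$ consists of the matrices $\begin{pmatrix}r&m\\0&s\end{pmatrix}$ ($r\in R$, $m\in M$, $s\in S$) with the usual matrix addition and multiplication. It is identified with the trivial extension $T(R\times S,M)$ (pairs $((r,s),m)$, multiplication $(a,m)(a',m')=(aa',am'+ma')$, where $(r,s)m=rm$ and $m(r,s)=ms$) and carries the corresponding grading: the even part $T_0$ is the set of diagonal matrices $\begin{pmatrix}r&0\\0&s\end{pmatrix}$ and the odd part $T_1$ is the set of matrices $\begin{pmatrix}0&m\\0&0\end{pmatrix}$. *)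

theory Defs
  imports "HOL-Algebra.AbelCoset" "HOL-Algebra.Module" "HOL-Library.Z2"
begin

definition two_torsion_free :: "('a, 'b) ring_scheme \<Rightarrow> bool" where
  "two_torsion_free A \<longleftrightarrow>
     (\<forall>x\<in>carrier A. x \<oplus>\<^bsub>A\<^esub> x = \<zero>\<^bsub>A\<^esub> \<longrightarrow> x = \<zero>\<^bsub>A\<^esub>)"

abbreviation additive_map :: "('a, 'b) ring_scheme \<Rightarrow> ('a \<Rightarrow> 'a) \<Rightarrow> bool" where
  "additive_map A f \<equiv> f \<in> hom (add_monoid A) (add_monoid A)"


section \<open>Jordan derivations\<close>

definition jordan_prod :: "('a, 'b) ring_scheme \<Rightarrow> 'a \<Rightarrow> 'a \<Rightarrow> 'a" where
  "jordan_prod A x y = x \<otimes>\<^bsub>A\<^esub> y \<oplus>\<^bsub>A\<^esub> y \<otimes>\<^bsub>A\<^esub> x"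

definition jordan_derivation :: "('a, 'b) ring_scheme \<Rightarrow> ('a \<Rightarrow> 'a) \<Rightarrow> bool" where
  "jordan_derivation A d \<longleftrightarrow>
     additive_map A d \<and>
     (\<forall>x\<in>carrier A. \<forall>y\<in>carrier A.
        d (jordan_prod A x y) = jordan_prod A (d x) y \<oplus>\<^bsub>A\<^esub> jordan_prod A x (d y))"


section \<open>Superrings and Jordan superderivations\<close>

text \<open>The grading is a family of additive subgroups indexed by the two-element type
  \<^typ>\<open>bit\<close>, whose addition is addition modulo 2.\<close>

locale superring = ring A for A :: "('a, 'b) ring_scheme" (structure) +
  fixes G :: "bit \<Rightarrow> 'a set"
  assumes homogeneous_subgroup: "additive_subgroup (G i) A"
    and sum_eq_carrier: "G 0 <+>\<^bsub>A\<^esub> G 1 = carrier A"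
    and inter_eq_zero: "G 0 \<inter> G 1 = {\<zero>\<^bsub>A\<^esub>}"
    and mult_graded: "\<lbrakk>x \<in> G i; y \<in> G j\<rbrakk> \<Longrightarrow> x \<otimes>\<^bsub>A\<^esub> y \<in> G (i + j)"

text \<open>The element $(-1)^k x$.\<close>

definition signed :: "('a, 'b) ring_scheme \<Rightarrow> bit \<Rightarrow> 'a \<Rightarrow> 'a" where
  "signed A k x = (if k = 1 then \<ominus>\<^bsub>A\<^esub> x else x)"

text \<open>The Jordan superproduct of \<open>x\<close> of degree \<open>i\<close> and \<open>y\<close> of degree \<open>j\<close>.  The degrees are
  explicit arguments because the zero element is homogeneous of both degrees; the superproduct
  with zero is zero whichever degree is used.\<close>

definition jordan_superprod ::
    "('a, 'b) ring_scheme \<Rightarrow> bit \<Rightarrow> bit \<Rightarrow> 'a \<Rightarrow> 'a \<Rightarrow> 'a" where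
  "jordan_superprod A i j x y = x \<otimes>\<^bsub>A\<^esub> y \<oplus>\<^bsub>A\<^esub> signed A (i * j) (y \<otimes>\<^bsub>A\<^esub> x)"

definition jordan_superderivation_of_degree ::
    "('a, 'b) ring_scheme \<Rightarrow> (bit \<Rightarrow> 'a set) \<Rightarrow> bit \<Rightarrow> ('a \<Rightarrow> 'a) \<Rightarrow> bool" where
  "jordan_superderivation_of_degree A G i d \<longleftrightarrow>
     additive_map A d \<and>
     (\<forall>j. d ` G j \<subseteq> G (i + j)) \<and>
     (\<forall>j k. \<forall>x\<in>G j. \<forall>y\<in>G k.
        d (jordan_superprod A j k x y) =
          jordan_superprod A (i + j) k (d x) y \<oplus>\<^bsub>A\<^esub>
          signed A (i * j) (jordan_superprod A j (i + k) x (d y)))"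

definition jordan_superderivation ::
    "('a, 'b) ring_scheme \<Rightarrow> (bit \<Rightarrow> 'a set) \<Rightarrow> ('a \<Rightarrow> 'a) \<Rightarrow> bool" where
  "jordan_superderivation A G d \<longleftrightarrow>
     (\<exists>d0 d1. jordan_superderivation_of_degree A G 0 d0 \<and>
              jordan_superderivation_of_degree A G 1 d1 \<and>
              (\<forall>x\<in>carrier A. d x = d0 x \<oplus>\<^bsub>A\<^esub> d1 x))"


section \<open>Bimodules\<close>

text \<open>As in the library's \<^locale>\<open>module\<close>, the multiplicative fields inherited from the ring
  record play no role.  The library locale itself is not reused because it requires a
  commutative ring of scalars.\<close>

record ('r, 'm, 's) bimodule = "('r, 'm) module" +
  rsmult :: "'m \<Rightarrow> 's \<Rightarrow> 'm" (infixl \<open>\<odot>r\<index>\<close> 70)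

locale bimodule = R: ring R + S: ring S + M: abelian_group M
  for R :: "('r, 'a) ring_scheme" and S :: "('s, 'b) ring_scheme"
    and M :: "('r, 'm, 's, 'c) bimodule_scheme" +
  assumes lsmult_closed: "\<lbrakk>r \<in> carrier R; m \<in> carrier M\<rbrakk> \<Longrightarrow> r \<odot>\<^bsub>M\<^esub> m \<in> carrier M"
    and lsmult_l_distr: "\<lbrakk>r \<in> carrier R; r' \<in> carrier R; m \<in> carrier M\<rbrakk> \<Longrightarrow>
      (r \<oplus>\<^bsub>R\<^esub> r') \<odot>\<^bsub>M\<^esub> m = r \<odot>\<^bsub>M\<^esub> m \<oplus>\<^bsub>M\<^esub> r' \<odot>\<^bsub>M\<^esub> m"
    and lsmult_r_distr: "\<lbrakk>r \<in> carrier R; m \<in> carrier M; m' \<in> carrier M\<rbrakk> \<Longrightarrow>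
      r \<odot>\<^bsub>M\<^esub> (m \<oplus>\<^bsub>M\<^esub> m') = r \<odot>\<^bsub>M\<^esub> m \<oplus>\<^bsub>M\<^esub> r \<odot>\<^bsub>M\<^esub> m'"
    and lsmult_assoc: "\<lbrakk>r \<in> carrier R; r' \<in> carrier R; m \<in> carrier M\<rbrakk> \<Longrightarrow>
      (r \<otimes>\<^bsub>R\<^esub> r') \<odot>\<^bsub>M\<^esub> m = r \<odot>\<^bsub>M\<^esub> (r' \<odot>\<^bsub>M\<^esub> m)"
    and lsmult_one: "m \<in> carrier M \<Longrightarrow> \<one>\<^bsub>R\<^esub> \<odot>\<^bsub>M\<^esub> m = m"
    and rsmult_closed: "\<lbrakk>m \<in> carrier M; s \<in> carrier S\<rbrakk> \<Longrightarrow> m \<odot>r\<^bsub>M\<^esub> s \<in> carrier M"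
    and rsmult_r_distr: "\<lbrakk>m \<in> carrier M; s \<in> carrier S; s' \<in> carrier S\<rbrakk> \<Longrightarrow>
      m \<odot>r\<^bsub>M\<^esub> (s \<oplus>\<^bsub>S\<^esub> s') = m \<odot>r\<^bsub>M\<^esub> s \<oplus>\<^bsub>M\<^esub> m \<odot>r\<^bsub>M\<^esub> s'"
    and rsmult_l_distr: "\<lbrakk>m \<in> carrier M; m' \<in> carrier M; s \<in> carrier S\<rbrakk> \<Longrightarrow>
      (m \<oplus>\<^bsub>M\<^esub> m') \<odot>r\<^bsub>M\<^esub> s = m \<odot>r\<^bsub>M\<^esub> s \<oplus>\<^bsub>M\<^esub> m' \<odot>r\<^bsub>M\<^esub> s"
    and rsmult_assoc: "\<lbrakk>m \<in> carrier M; s \<in> carrier S; s' \<in> carrier S\<rbrakk> \<Longrightarrow>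
      m \<odot>r\<^bsub>M\<^esub> (s \<otimes>\<^bsub>S\<^esub> s') = (m \<odot>r\<^bsub>M\<^esub> s) \<odot>r\<^bsub>M\<^esub> s'"
    and rsmult_one: "m \<in> carrier M \<Longrightarrow> m \<odot>r\<^bsub>M\<^esub> \<one>\<^bsub>S\<^esub> = m"
    and lsmult_rsmult_assoc: "\<lbrakk>r \<in> carrier R; m \<in> carrier M; s \<in> carrier S\<rbrakk> \<Longrightarrow>
      (r \<odot>\<^bsub>M\<^esub> m) \<odot>r\<^bsub>M\<^esub> s = r \<odot>\<^bsub>M\<^esub> (m \<odot>r\<^bsub>M\<^esub> s)"


section \<open>The triangular matrix ring\<close>

text \<open>\<open>Tri r m s\<close> is the matrix with rows \<open>(r, m)\<close> and \<open>(0, s)\<close>.\<close>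

datatype ('r, 'm, 's) tri = Tri 'r 'm 's

fun tri_mult :: "('r, 'a) ring_scheme \<Rightarrow> ('s, 'b) ring_scheme \<Rightarrow> ('r, 'm, 's, 'c) bimodule_scheme \<Rightarrow>
    ('r, 'm, 's) tri \<Rightarrow> ('r, 'm, 's) tri \<Rightarrow> ('r, 'm, 's) tri" where
  "tri_mult R S M (Tri r m s) (Tri r' m' s') =
     Tri (r \<otimes>\<^bsub>R\<^esub> r') (r \<odot>\<^bsub>M\<^esub> m' \<oplus>\<^bsub>M\<^esub> m \<odot>r\<^bsub>M\<^esub> s') (s \<otimes>\<^bsub>S\<^esub> s')"

fun tri_add :: "('r, 'a) ring_scheme \<Rightarrow> ('s, 'b) ring_scheme \<Rightarrow> ('r, 'm, 's, 'c) bimodule_scheme \<Rightarrow>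
    ('r, 'm, 's) tri \<Rightarrow> ('r, 'm, 's) tri \<Rightarrow> ('r, 'm, 's) tri" where
  "tri_add R S M (Tri r m s) (Tri r' m' s') =
     Tri (r \<oplus>\<^bsub>R\<^esub> r') (m \<oplus>\<^bsub>M\<^esub> m') (s \<oplus>\<^bsub>S\<^esub> s')"

definition tri_ring :: "('r, 'a) ring_scheme \<Rightarrow> ('s, 'b) ring_scheme \<Rightarrow>
    ('r, 'm, 's, 'c) bimodule_scheme \<Rightarrow> ('r, 'm, 's) tri ring" where
  "tri_ring R S M =
     \<lparr>carrier = {Tri r m s | r m s. r \<in> carrier R \<and> m \<in> carrier M \<and> s \<in> carrier S},
      mult = tri_mult R S M,
      one = Tri \<one>\<^bsub>R\<^esub> \<zero>\<^bsub>M\<^esub> \<one>\<^bsub>S\<^esub>,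
      zero = Tri \<zero>\<^bsub>R\<^esub> \<zero>\<^bsub>M\<^esub> \<zero>\<^bsub>S\<^esub>,
      add = tri_add R S M\<rparr>"

definition tri_grading :: "('r, 'a) ring_scheme \<Rightarrow> ('s, 'b) ring_scheme \<Rightarrow>
    ('r, 'm, 's, 'c) bimodule_scheme \<Rightarrow> bit \<Rightarrow> ('r, 'm, 's) tri set" where
  "tri_grading R S M i =
     (if i = 0 then {Tri r \<zero>\<^bsub>M\<^esub> s | r s. r \<in> carrier R \<and> s \<in> carrier S}
      else {Tri \<zero>\<^bsub>R\<^esub> m \<zero>\<^bsub>S\<^esub> | m. m \<in> carrier M})"

context bimodule
begin

lemma lsmult_zero_left: "m \<in> carrier M \<Longrightarrow> \<zero>\<^bsub>R\<^esub> \<odot>\<^bsub>M\<^esub> m = \<zero>\<^bsub>M\<^esub>"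
  using lsmult_l_distr[of "\<zero>\<^bsub>R\<^esub>" "\<zero>\<^bsub>R\<^esub>" m] lsmult_closed[of "\<zero>\<^bsub>R\<^esub>" m]
  by (simp add: M.add.l_cancel_one')

lemma lsmult_zero_right: "r \<in> carrier R \<Longrightarrow> r \<odot>\<^bsub>M\<^esub> \<zero>\<^bsub>M\<^esub> = \<zero>\<^bsub>M\<^esub>"
  using lsmult_r_distr[of r "\<zero>\<^bsub>M\<^esub>" "\<zero>\<^bsub>M\<^esub>"] lsmult_closed[of r "\<zero>\<^bsub>M\<^esub>"]
  by (simp add: M.add.l_cancel_one')

lemma rsmult_zero_right: "m \<in> carrier M \<Longrightarrow> m \<odot>r\<^bsub>M\<^esub> \<zero>\<^bsub>S\<^esub> = \<zero>\<^bsub>M\<^esub>"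
  using rsmult_r_distr[of m "\<zero>\<^bsub>S\<^esub>" "\<zero>\<^bsub>S\<^esub>"] rsmult_closed[of m "\<zero>\<^bsub>S\<^esub>"]
  by (simp add: M.add.l_cancel_one')

lemma rsmult_zero_left: "s \<in> carrier S \<Longrightarrow> \<zero>\<^bsub>M\<^esub> \<odot>r\<^bsub>M\<^esub> s = \<zero>\<^bsub>M\<^esub>"
  using rsmult_l_distr[of "\<zero>\<^bsub>M\<^esub>" "\<zero>\<^bsub>M\<^esub>" s] rsmult_closed[of "\<zero>\<^bsub>M\<^esub>" s]
  by (simp add: M.add.l_cancel_one')

lemmas smult_simps = lsmult_closed rsmult_closed lsmult_l_distr lsmult_r_distr lsmult_assoc
  lsmult_one rsmult_l_distr rsmult_r_distr rsmult_assoc rsmult_one lsmult_rsmult_assoc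
  lsmult_zero_left lsmult_zero_right rsmult_zero_left rsmult_zero_right

lemma tri_ring_ring: "ring (tri_ring R S M)"
proof (rule ringI)
  show "abelian_group (tri_ring R S M)"
  proof (rule abelian_groupI)
    fix x assume "x \<in> carrier (tri_ring R S M)"
    then obtain r m s where x: "x = Tri r m s" "r \<in> carrier R" "m \<in> carrier M" "s \<in> carrier S"
      by (auto simp: tri_ring_def)
    then have "Tri (\<ominus>\<^bsub>R\<^esub> r) (\<ominus>\<^bsub>M\<^esub> m) (\<ominus>\<^bsub>S\<^esub> s) \<in> carrier (tri_ring R S M)"
      "Tri (\<ominus>\<^bsub>R\<^esub> r) (\<ominus>\<^bsub>M\<^esub> m) (\<ominus>\<^bsub>S\<^esub> s) \<oplus>\<^bsub>tri_ring R S M\<^esub> x = \<zero>\<^bsub>tri_ring R S M\<^esub>"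
      by (auto simp: tri_ring_def R.l_neg S.l_neg M.l_neg)
    then show "\<exists>y\<in>carrier (tri_ring R S M). y \<oplus>\<^bsub>tri_ring R S M\<^esub> x = \<zero>\<^bsub>tri_ring R S M\<^esub>" by blast
  qed (auto simp: tri_ring_def R.a_ac S.a_ac M.a_ac)
  show "monoid (tri_ring R S M)"
    by (rule monoidI) (auto simp: tri_ring_def smult_simps R.m_assoc S.m_assoc M.a_assoc)
qed (auto simp: tri_ring_def smult_simps R.l_distr R.r_distr S.l_distr S.r_distr M.a_ac)

theorem tri_ring_superring: "superring (tri_ring R S M) (tri_grading R S M)"
proof (intro superring.intro superring_axioms.intro)
  let ?T = "tri_ring R S M" and ?G = "tri_grading R S M"
  interpret T: ring ?T by (rule tri_ring_ring)
  show "ring ?T" by (rule tri_ring_ring)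
  have neg: "\<ominus>\<^bsub>?T\<^esub> Tri r m s = Tri (\<ominus>\<^bsub>R\<^esub> r) (\<ominus>\<^bsub>M\<^esub> m) (\<ominus>\<^bsub>S\<^esub> s)"
    if "r \<in> carrier R" "m \<in> carrier M" "s \<in> carrier S" for r m s
    by (rule T.minus_equality) (use that in \<open>auto simp: tri_ring_def R.l_neg S.l_neg M.l_neg\<close>)
  show "additive_subgroup (?G i) ?T" for i
  proof (intro additive_subgroup.intro T.add.subgroupI)
    show "?G i \<subseteq> carrier ?T" by (auto simp: tri_grading_def tri_ring_def)
    show "?G i \<noteq> {}" by (auto simp: tri_grading_def)
    show "\<ominus>\<^bsub>?T\<^esub> a \<in> ?G i" if "a \<in> ?G i" for a
      using that neg  by (auto simp: tri_grading_def split: if_splits)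
    show "a \<oplus>\<^bsub>?T\<^esub> b \<in> ?G i" if "a \<in> ?G i" "b \<in> ?G i" for a b
      using that by (auto simp: tri_grading_def tri_ring_def split: if_splits)
  qed
  have "Tri r m s \<in> ?G 0 <+>\<^bsub>?T\<^esub> ?G 1"
    if "r \<in> carrier R" "m \<in> carrier M" "s \<in> carrier S" for r m s
  proof -
    have "Tri r \<zero>\<^bsub>M\<^esub> s \<in> ?G 0" "Tri \<zero>\<^bsub>R\<^esub> m \<zero>\<^bsub>S\<^esub> \<in> ?G 1"
      and "Tri r m s = Tri r \<zero>\<^bsub>M\<^esub> s \<oplus>\<^bsub>?T\<^esub> Tri \<zero>\<^bsub>R\<^esub> m \<zero>\<^bsub>S\<^esub>"
      using that by (auto simp: tri_grading_def tri_ring_def)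
    then show ?thesis unfolding set_add_def' by blast
  qed
  then show "?G 0 <+>\<^bsub>?T\<^esub> ?G 1 = carrier ?T"
    by (auto simp: set_add_def' tri_ring_def) (auto simp: tri_grading_def)
  show "?G 0 \<inter> ?G 1 = {\<zero>\<^bsub>?T\<^esub>}" by (auto simp: tri_grading_def tri_ring_def)
  show "x \<otimes>\<^bsub>?T\<^esub> y \<in> ?G (i + j)" if "x \<in> ?G i" "y \<in> ?G j" for x y i j
    using that by (cases i; cases j) (auto simp: tri_grading_def tri_ring_def smult_simps)
qed

end

end

theory Submission
  imports Defs
begin

text \<open>
  The degree of a homogeneous map already dictates its shape: in degree 0 it preserves diagonal and
  strictly upper triangular matrices, in degree 1 it swaps them.  The rest comes from evaluating the
  superderivation identity at a few products.

  In degree 0, \<open>diag(r,0)\<close> and \<open>diag(0,s)\<close> annihilate each other, so the \<open>S\<close>-entry of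
  \<open>d diag(r,0)\<close> has zero Jordan product with every \<open>s\<close>, in particular with the identity: its
  double is zero, hence it is zero because \<open>S\<close> is 2-torsion free.  Symmetrically for
  \<open>diag(0,s)\<close>.  So \<open>d\<close> acts entrywise, by maps \<open>\<delta>\<^sub>1\<close>, \<open>g\<close>, \<open>\<delta>\<^sub>2\<close>, and the
  identity for two diagonal matrices, respectively for a diagonal and an upper one, says exactly
  what is claimed about them (\<open>degree_0_form\<close>).

  In degree 1, let \<open>e = diag(1,0)\<close> and let \<open>m'\<close> be the upper entry of \<open>d e\<close>.  Multiplying
  \<open>e\<close> by \<open>diag(r,0)\<close> and by \<open>diag(0,s)\<close> determines \<open>d\<close> on diagonal matrices.  For an upper
  matrix \<open>Y\<close> one has \<open>e \<circ> Y = Y\<close>, and the superproduct of \<open>d e\<close> with \<open>Y\<close> vanishes because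
  products of upper matrices do; so \<open>d Y = e \<circ> d Y\<close>.  The \<open>R\<close>-entry of \<open>d Y\<close> is thus its own
  double, and \<open>e \<circ> d Y\<close> has no \<open>S\<close>-entry.  Hence \<open>d Y = 0\<close>, and \<open>d X\<close> is the commutator
  \<open>X N - N X\<close> with the upper matrix \<open>N\<close> whose entry is \<open>m'\<close> (\<open>degree_1_form\<close>).

  Conversely, maps of these two shapes are Jordan derivations of \<open>T\<close>: in degree 0 the properties
  of \<open>\<delta>\<^sub>1\<close>, \<open>g\<close>, \<open>\<delta>\<^sub>2\<close> add up to the Jordan identity, and in degree 1 a commutator map is
  even a derivation.
\<close>

section \<open>Jordan products and superproducts\<close>

lemma jordan_superprod_even [simp]:
  "jordan_superprod A 0 k x y = jordan_prod A x y"
  "jordan_superprod A j 0 x y = jordan_prod A x y"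
  by (simp_all add: jordan_superprod_def jordan_prod_def signed_def)

text \<open>An even left factor contributes no sign, whatever the degree of the superderivation; only
  the superproduct with \<open>d x\<close> can differ from a Jordan product.\<close>

lemma jordan_superderivation_even_left:
  assumes "jordan_superderivation_of_degree A G i d" "x \<in> G 0" "y \<in> G k"
  shows "d (jordan_prod A x y) = jordan_superprod A i k (d x) y \<oplus>\<^bsub>A\<^esub> jordan_prod A x (d y)"
proof -
  have "d (jordan_superprod A 0 k x y) =
      jordan_superprod A (i + 0) k (d x) y \<oplus>\<^bsub>A\<^esub>
      signed A (i * 0) (jordan_superprod A 0 (i + k) x (d y))"
    using assms unfolding jordan_superderivation_of_degree_def by blast
  then show ?thesis by (simp add: signed_def)
qed

context ring
begin

lemma jordan_prod_closed [simp]: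
  "\<lbrakk>x \<in> carrier R; y \<in> carrier R\<rbrakk> \<Longrightarrow> jordan_prod R x y \<in> carrier R"
  by (simp add: jordan_prod_def)

lemma jordan_prod_one: "x \<in> carrier R \<Longrightarrow> jordan_prod R \<one> x = x \<oplus> x"
  by (simp add: jordan_prod_def)

lemma jordan_prod_commute:
  "\<lbrakk>x \<in> carrier R; y \<in> carrier R\<rbrakk> \<Longrightarrow> jordan_prod R x y = jordan_prod R y x"
  by (simp add: jordan_prod_def a_comm)

lemma jordan_prod_zero [simp]:
  "x \<in> carrier R \<Longrightarrow> jordan_prod R \<zero> x = \<zero>"
  "x \<in> carrier R \<Longrightarrow> jordan_prod R x \<zero> = \<zero>"
  by (simp_all add: jordan_prod_def)

lemma jordan_prod_add:
  assumes "x \<in> carrier R" "y \<in> carrier R" "z \<in> carrier R"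
  shows "jordan_prod R (x \<oplus> y) z = jordan_prod R x z \<oplus> jordan_prod R y z"
    and "jordan_prod R z (x \<oplus> y) = jordan_prod R z x \<oplus> jordan_prod R z y"
  using assms by (simp_all add: jordan_prod_def l_distr r_distr a_ac)

lemma jordan_derivation_sum:
  assumes "jordan_derivation R d" "jordan_derivation R d'"
    and sum: "\<And>x. x \<in> carrier R \<Longrightarrow> h x = d x \<oplus> d' x"
  shows "jordan_derivation R h"
proof -
  have closed: "d x \<in> carrier R" "d' x \<in> carrier R" if "x \<in> carrier R" for x
    using assms that by (auto simp: jordan_derivation_def hom_def)
  have add: "d (x \<oplus> y) = d x \<oplus> d y" "d' (x \<oplus> y) = d' x \<oplus> d' y"
    if "x \<in> carrier R" "y \<in> carrier R" for x y
    using assms that by (auto simp: jordan_derivation_def hom_def)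
  have jordan: "d (jordan_prod R x y) = jordan_prod R (d x) y \<oplus> jordan_prod R x (d y)"
    "d' (jordan_prod R x y) = jordan_prod R (d' x) y \<oplus> jordan_prod R x (d' y)"
    if "x \<in> carrier R" "y \<in> carrier R" for x y
    using assms that by (auto simp: jordan_derivation_def)
  show ?thesis
    by (auto simp: jordan_derivation_def hom_def sum closed add jordan jordan_prod_add a_ac)
qed

end

section \<open>Computing in the triangular matrix ring\<close>

context bimodule
begin

abbreviation T where "T \<equiv> tri_ring R S M"
abbreviation G where "G \<equiv> tri_grading R S M"

lemma tri_carrier_iff [simp]:
  "Tri r m s \<in> carrier T \<longleftrightarrow> r \<in> carrier R \<and> m \<in> carrier M \<and> s \<in> carrier S"
  by (simp add: tri_ring_def)

lemma tri_carrierE: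
  assumes "x \<in> carrier T"
  obtains r m s where "x = Tri r m s" "r \<in> carrier R" "m \<in> carrier M" "s \<in> carrier S"
  using assms by (auto simp: tri_ring_def)

lemma tri_add_eq [simp]:
  "Tri r m s \<oplus>\<^bsub>T\<^esub> Tri r' m' s' = Tri (r \<oplus>\<^bsub>R\<^esub> r') (m \<oplus>\<^bsub>M\<^esub> m') (s \<oplus>\<^bsub>S\<^esub> s')"
  by (simp add: tri_ring_def)

lemma tri_mult_eq:
  "Tri r m s \<otimes>\<^bsub>T\<^esub> Tri r' m' s' =
    Tri (r \<otimes>\<^bsub>R\<^esub> r') (r \<odot>\<^bsub>M\<^esub> m' \<oplus>\<^bsub>M\<^esub> m \<odot>r\<^bsub>M\<^esub> s') (s \<otimes>\<^bsub>S\<^esub> s')"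
  by (simp add: tri_ring_def)

lemma diagonal_even [simp]:
  "\<lbrakk>r \<in> carrier R; s \<in> carrier S\<rbrakk> \<Longrightarrow> Tri r \<zero>\<^bsub>M\<^esub> s \<in> G 0"
  by (simp add: tri_grading_def)

lemma upper_odd [simp]: "m \<in> carrier M \<Longrightarrow> Tri \<zero>\<^bsub>R\<^esub> m \<zero>\<^bsub>S\<^esub> \<in> G 1"
  by (simp add: tri_grading_def)

lemma evenE:
  assumes "x \<in> G 0"
  obtains r s where "x = Tri r \<zero>\<^bsub>M\<^esub> s" "r \<in> carrier R" "s \<in> carrier S"
  using assms by (auto simp: tri_grading_def)

lemma oddE:
  assumes "x \<in> G 1"
  obtains m where "x = Tri \<zero>\<^bsub>R\<^esub> m \<zero>\<^bsub>S\<^esub>" "m \<in> carrier M"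
  using assms by (auto simp: tri_grading_def)

lemma jordan_prod_tri [simp]:
  "jordan_prod T (Tri r m s) (Tri r' m' s') =
    Tri (jordan_prod R r r')
      ((r \<odot>\<^bsub>M\<^esub> m' \<oplus>\<^bsub>M\<^esub> m \<odot>r\<^bsub>M\<^esub> s') \<oplus>\<^bsub>M\<^esub> (r' \<odot>\<^bsub>M\<^esub> m \<oplus>\<^bsub>M\<^esub> m' \<odot>r\<^bsub>M\<^esub> s))
      (jordan_prod S s s')"
  by (simp add: jordan_prod_def tri_mult_eq)

text \<open>Upper matrices square to zero, so the signs in superproducts of odd elements never show.\<close>

lemma jordan_superprod_upper:
  assumes "m \<in> carrier M" "m' \<in> carrier M"
  shows "jordan_superprod T j k (Tri \<zero>\<^bsub>R\<^esub> m \<zero>\<^bsub>S\<^esub>) (Tri \<zero>\<^bsub>R\<^esub> m' \<zero>\<^bsub>S\<^esub>) = Tri \<zero>\<^bsub>R\<^esub> \<zero>\<^bsub>M\<^esub> \<zero>\<^bsub>S\<^esub>"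
proof -
  interpret T: ring T by (rule tri_ring_ring)
  have zero: "\<zero>\<^bsub>T\<^esub> = Tri \<zero>\<^bsub>R\<^esub> \<zero>\<^bsub>M\<^esub> \<zero>\<^bsub>S\<^esub>" by (simp add: tri_ring_def)
  have "Tri \<zero>\<^bsub>R\<^esub> n \<zero>\<^bsub>S\<^esub> \<otimes>\<^bsub>T\<^esub> Tri \<zero>\<^bsub>R\<^esub> n' \<zero>\<^bsub>S\<^esub> = \<zero>\<^bsub>T\<^esub>"
    if "n \<in> carrier M" "n' \<in> carrier M" for n n'
    using that by (simp add: tri_mult_eq smult_simps zero)
  with assms have "jordan_superprod T j k (Tri \<zero>\<^bsub>R\<^esub> m \<zero>\<^bsub>S\<^esub>) (Tri \<zero>\<^bsub>R\<^esub> m' \<zero>\<^bsub>S\<^esub>) = \<zero>\<^bsub>T\<^esub>"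
    by (simp add: jordan_superprod_def signed_def)
  then show ?thesis by (simp only: zero)
qed

lemma superderivation_image:
  assumes "jordan_superderivation_of_degree T G i d" "x \<in> G j"
  shows "d x \<in> G (i + j)"
  using assms unfolding jordan_superderivation_of_degree_def by blast

lemma superderivation_add:
  assumes "jordan_superderivation_of_degree T G i d" "x \<in> carrier T" "y \<in> carrier T"
  shows "d (x \<oplus>\<^bsub>T\<^esub> y) = d x \<oplus>\<^bsub>T\<^esub> d y"
  using assms by (simp add: jordan_superderivation_of_degree_def hom_def)

text \<open>By additivity it is enough to know a superderivation on matrices with a single entry.\<close>

lemma superderivation_entries:
  assumes "jordan_superderivation_of_degree T G i d"
    and "r \<in> carrier R" "m \<in> carrier M" "s \<in> carrier S"
  shows "d (Tri r m s) =
    d (Tri r \<zero>\<^bsub>M\<^esub> \<zero>\<^bsub>S\<^esub>) \<oplus>\<^bsub>T\<^esub> d (Tri \<zero>\<^bsub>R\<^esub> m \<zero>\<^bsub>S\<^esub>) \<oplus>\<^bsub>T\<^esub> d (Tri \<zero>\<^bsub>R\<^esub> \<zero>\<^bsub>M\<^esub> s)"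
proof -
  have "d (Tri r m s) =
      d ((Tri r \<zero>\<^bsub>M\<^esub> \<zero>\<^bsub>S\<^esub> \<oplus>\<^bsub>T\<^esub> Tri \<zero>\<^bsub>R\<^esub> m \<zero>\<^bsub>S\<^esub>) \<oplus>\<^bsub>T\<^esub> Tri \<zero>\<^bsub>R\<^esub> \<zero>\<^bsub>M\<^esub> s)"
    using assms(2-) by simp
  also have "\<dots> = d (Tri r \<zero>\<^bsub>M\<^esub> \<zero>\<^bsub>S\<^esub> \<oplus>\<^bsub>T\<^esub> Tri \<zero>\<^bsub>R\<^esub> m \<zero>\<^bsub>S\<^esub>) \<oplus>\<^bsub>T\<^esub> d (Tri \<zero>\<^bsub>R\<^esub> \<zero>\<^bsub>M\<^esub> s)"
    by (rule superderivation_add[OF assms(1)]) (use assms(2-) in simp_all)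
  also have "d (Tri r \<zero>\<^bsub>M\<^esub> \<zero>\<^bsub>S\<^esub> \<oplus>\<^bsub>T\<^esub> Tri \<zero>\<^bsub>R\<^esub> m \<zero>\<^bsub>S\<^esub>) =
      d (Tri r \<zero>\<^bsub>M\<^esub> \<zero>\<^bsub>S\<^esub>) \<oplus>\<^bsub>T\<^esub> d (Tri \<zero>\<^bsub>R\<^esub> m \<zero>\<^bsub>S\<^esub>)"
    by (rule superderivation_add[OF assms(1)]) (use assms(2-) in simp_all)
  finally show ?thesis .
qed

section \<open>Degree 0\<close>

text \<open>The cross terms \<open>\<alpha>\<close> and \<open>\<beta>\<close>, which would move entries between \<open>R\<close> and \<open>S\<close>, vanish
  because they have zero Jordan product with an identity element.\<close>

lemma degree_0_entrywise:
  assumes d: "jordan_superderivation_of_degree T G 0 d"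
    and tfR: "two_torsion_free R" and tfS: "two_torsion_free S"
  obtains \<delta>\<^sub>1 \<delta>\<^sub>2 g where
    "\<And>r. r \<in> carrier R \<Longrightarrow> \<delta>\<^sub>1 r \<in> carrier R"
    "\<And>m. m \<in> carrier M \<Longrightarrow> g m \<in> carrier M"
    "\<And>s. s \<in> carrier S \<Longrightarrow> \<delta>\<^sub>2 s \<in> carrier S"
    "\<And>r m s. \<lbrakk>r \<in> carrier R; m \<in> carrier M; s \<in> carrier S\<rbrakk> \<Longrightarrow>
      d (Tri r m s) = Tri (\<delta>\<^sub>1 r) (g m) (\<delta>\<^sub>2 s)"
proof -
  have "\<exists>a b. d (Tri r \<zero>\<^bsub>M\<^esub> \<zero>\<^bsub>S\<^esub>) = Tri a \<zero>\<^bsub>M\<^esub> b \<and> a \<in> carrier R \<and> b \<in> carrier S"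
    if "r \<in> carrier R" for r
    using superderivation_image[OF d, of "Tri r \<zero>\<^bsub>M\<^esub> \<zero>\<^bsub>S\<^esub>" 0] that by (auto elim: evenE)
  then obtain \<delta>\<^sub>1 \<beta> where R_image: "\<And>r. r \<in> carrier R \<Longrightarrow>
      d (Tri r \<zero>\<^bsub>M\<^esub> \<zero>\<^bsub>S\<^esub>) = Tri (\<delta>\<^sub>1 r) \<zero>\<^bsub>M\<^esub> (\<beta> r) \<and> \<delta>\<^sub>1 r \<in> carrier R \<and> \<beta> r \<in> carrier S"
    by metis
  have "\<exists>a b. d (Tri \<zero>\<^bsub>R\<^esub> \<zero>\<^bsub>M\<^esub> s) = Tri a \<zero>\<^bsub>M\<^esub> b \<and> a \<in> carrier R \<and> b \<in> carrier S"
    if "s \<in> carrier S" for s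
    using superderivation_image[OF d, of "Tri \<zero>\<^bsub>R\<^esub> \<zero>\<^bsub>M\<^esub> s" 0] that by (auto elim: evenE)
  then obtain \<alpha> \<delta>\<^sub>2 where S_image: "\<And>s. s \<in> carrier S \<Longrightarrow>
      d (Tri \<zero>\<^bsub>R\<^esub> \<zero>\<^bsub>M\<^esub> s) = Tri (\<alpha> s) \<zero>\<^bsub>M\<^esub> (\<delta>\<^sub>2 s) \<and> \<alpha> s \<in> carrier R \<and> \<delta>\<^sub>2 s \<in> carrier S"
    by metis
  have "\<exists>n. d (Tri \<zero>\<^bsub>R\<^esub> m \<zero>\<^bsub>S\<^esub>) = Tri \<zero>\<^bsub>R\<^esub> n \<zero>\<^bsub>S\<^esub> \<and> n \<in> carrier M" if "m \<in> carrier M" for m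
    using superderivation_image[OF d, of "Tri \<zero>\<^bsub>R\<^esub> m \<zero>\<^bsub>S\<^esub>" 1] that by (auto elim: oddE)
  then obtain g where M_image: "\<And>m. m \<in> carrier M \<Longrightarrow>
      d (Tri \<zero>\<^bsub>R\<^esub> m \<zero>\<^bsub>S\<^esub>) = Tri \<zero>\<^bsub>R\<^esub> (g m) \<zero>\<^bsub>S\<^esub> \<and> g m \<in> carrier M"
    by metis

  have d_zero: "d (Tri \<zero>\<^bsub>R\<^esub> \<zero>\<^bsub>M\<^esub> \<zero>\<^bsub>S\<^esub>) = Tri \<zero>\<^bsub>R\<^esub> \<zero>\<^bsub>M\<^esub> \<zero>\<^bsub>S\<^esub>"
    using R_image[of "\<zero>\<^bsub>R\<^esub>"] M_image[of "\<zero>\<^bsub>M\<^esub>"] by simp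
  (* diag(r,0) and diag(0,s) have Jordan product 0 *)
  have cross: "jordan_prod R r (\<alpha> s) = \<zero>\<^bsub>R\<^esub> \<and> jordan_prod S (\<beta> r) s = \<zero>\<^bsub>S\<^esub>"
    if "r \<in> carrier R" "s \<in> carrier S" for r s
    using jordan_superderivation_even_left[OF d, of "Tri r \<zero>\<^bsub>M\<^esub> \<zero>\<^bsub>S\<^esub>" "Tri \<zero>\<^bsub>R\<^esub> \<zero>\<^bsub>M\<^esub> s" 0]
      R_image[of r] S_image[of s] that d_zero
    by (simp add: smult_simps)
  have \<alpha>: "\<alpha> s = \<zero>\<^bsub>R\<^esub>" if "s \<in> carrier S" for s
    using cross[of "\<one>\<^bsub>R\<^esub>" s] S_image[of s] tfR that R.jordan_prod_one[of "\<alpha> s"]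
    unfolding two_torsion_free_def by (metis R.one_closed)
  have \<beta>: "\<beta> r = \<zero>\<^bsub>S\<^esub>" if "r \<in> carrier R" for r
    using cross[of r "\<one>\<^bsub>S\<^esub>"] R_image[of r] tfS that S.jordan_prod_one[of "\<beta> r"]
    unfolding two_torsion_free_def by (metis S.one_closed S.jordan_prod_commute)
  show thesis
  proof (rule that)
    show "d (Tri r m s) = Tri (\<delta>\<^sub>1 r) (g m) (\<delta>\<^sub>2 s)"
      if "r \<in> carrier R" "m \<in> carrier M" "s \<in> carrier S" for r m s
      using superderivation_entries[OF d that] R_image[of r] M_image[of m] S_image[of s] that
      by (simp add: \<alpha> \<beta>)
  qed (use R_image S_image M_image in blast)+
qed

text \<open>Once \<open>d\<close> is known to act entrywise, its additivity and its identities split into entries.\<close>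

lemma degree_0_form:
  assumes d: "jordan_superderivation_of_degree T G 0 d"
    and "two_torsion_free R" "two_torsion_free S"
  obtains \<delta>\<^sub>1 \<delta>\<^sub>2 g where
    "jordan_derivation R \<delta>\<^sub>1" "jordan_derivation S \<delta>\<^sub>2" "additive_map M g"
    "\<And>r m s. \<lbrakk>r \<in> carrier R; m \<in> carrier M; s \<in> carrier S\<rbrakk> \<Longrightarrow>
      g (r \<odot>\<^bsub>M\<^esub> m \<oplus>\<^bsub>M\<^esub> m \<odot>r\<^bsub>M\<^esub> s) =
        r \<odot>\<^bsub>M\<^esub> g m \<oplus>\<^bsub>M\<^esub> \<delta>\<^sub>1 r \<odot>\<^bsub>M\<^esub> m \<oplus>\<^bsub>M\<^esub> g m \<odot>r\<^bsub>M\<^esub> s \<oplus>\<^bsub>M\<^esub> m \<odot>r\<^bsub>M\<^esub> \<delta>\<^sub>2 s"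
    "\<And>r m s. \<lbrakk>r \<in> carrier R; m \<in> carrier M; s \<in> carrier S\<rbrakk> \<Longrightarrow>
      d (Tri r m s) = Tri (\<delta>\<^sub>1 r) (g m) (\<delta>\<^sub>2 s)"
proof (rule degree_0_entrywise[OF assms])
  fix \<delta>\<^sub>1 \<delta>\<^sub>2 g
  assume closed: "\<And>r. r \<in> carrier R \<Longrightarrow> \<delta>\<^sub>1 r \<in> carrier R"
      "\<And>m. m \<in> carrier M \<Longrightarrow> g m \<in> carrier M" "\<And>s. s \<in> carrier S \<Longrightarrow> \<delta>\<^sub>2 s \<in> carrier S"
    and form: "\<And>r m s. \<lbrakk>r \<in> carrier R; m \<in> carrier M; s \<in> carrier S\<rbrakk> \<Longrightarrow>
      d (Tri r m s) = Tri (\<delta>\<^sub>1 r) (g m) (\<delta>\<^sub>2 s)"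
  have add: "\<delta>\<^sub>1 (r \<oplus>\<^bsub>R\<^esub> r') = \<delta>\<^sub>1 r \<oplus>\<^bsub>R\<^esub> \<delta>\<^sub>1 r'" "g (m \<oplus>\<^bsub>M\<^esub> m') = g m \<oplus>\<^bsub>M\<^esub> g m'"
      "\<delta>\<^sub>2 (s \<oplus>\<^bsub>S\<^esub> s') = \<delta>\<^sub>2 s \<oplus>\<^bsub>S\<^esub> \<delta>\<^sub>2 s'"
    if "r \<in> carrier R" "r' \<in> carrier R" "m \<in> carrier M" "m' \<in> carrier M"
      "s \<in> carrier S" "s' \<in> carrier S" for r r' m m' s s'
    using superderivation_add[OF d, of "Tri r m s" "Tri r' m' s'"] that by (simp_all add: form)
  have zero: "\<delta>\<^sub>1 \<zero>\<^bsub>R\<^esub> = \<zero>\<^bsub>R\<^esub>" "g \<zero>\<^bsub>M\<^esub> = \<zero>\<^bsub>M\<^esub>" "\<delta>\<^sub>2 \<zero>\<^bsub>S\<^esub> = \<zero>\<^bsub>S\<^esub>"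
    using superderivation_image[OF d, of "Tri \<zero>\<^bsub>R\<^esub> \<zero>\<^bsub>M\<^esub> \<zero>\<^bsub>S\<^esub>" 0]
      superderivation_image[OF d, of "Tri \<zero>\<^bsub>R\<^esub> \<zero>\<^bsub>M\<^esub> \<zero>\<^bsub>S\<^esub>" 1]
    by (auto simp: form elim!: evenE oddE)
  have diag: "\<delta>\<^sub>1 (jordan_prod R r r') = jordan_prod R (\<delta>\<^sub>1 r) r' \<oplus>\<^bsub>R\<^esub> jordan_prod R r (\<delta>\<^sub>1 r')"
      "\<delta>\<^sub>2 (jordan_prod S s s') = jordan_prod S (\<delta>\<^sub>2 s) s' \<oplus>\<^bsub>S\<^esub> jordan_prod S s (\<delta>\<^sub>2 s')"
    if "r \<in> carrier R" "r' \<in> carrier R" "s \<in> carrier S" "s' \<in> carrier S" for r r' s s'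
    using jordan_superderivation_even_left[OF d, of "Tri r \<zero>\<^bsub>M\<^esub> s" "Tri r' \<zero>\<^bsub>M\<^esub> s'" 0] that
    by (simp_all add: form closed zero smult_simps)
  have upper: "g (r \<odot>\<^bsub>M\<^esub> m \<oplus>\<^bsub>M\<^esub> m \<odot>r\<^bsub>M\<^esub> s) =
      r \<odot>\<^bsub>M\<^esub> g m \<oplus>\<^bsub>M\<^esub> \<delta>\<^sub>1 r \<odot>\<^bsub>M\<^esub> m \<oplus>\<^bsub>M\<^esub> g m \<odot>r\<^bsub>M\<^esub> s \<oplus>\<^bsub>M\<^esub> m \<odot>r\<^bsub>M\<^esub> \<delta>\<^sub>2 s"
    if "r \<in> carrier R" "m \<in> carrier M" "s \<in> carrier S" for r m s
    using jordan_superderivation_even_left[OF d, of "Tri r \<zero>\<^bsub>M\<^esub> s" "Tri \<zero>\<^bsub>R\<^esub> m \<zero>\<^bsub>S\<^esub>" 1] that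
    by (simp add: form closed zero smult_simps M.a_ac)
  show thesis
    by (rule that[of \<delta>\<^sub>1 \<delta>\<^sub>2 g])
      (auto simp: jordan_derivation_def hom_def closed upper form
        intro: add(1)[OF _ _ M.zero_closed M.zero_closed S.zero_closed S.zero_closed]
          add(2)[OF R.zero_closed R.zero_closed _ _ S.zero_closed S.zero_closed]
          add(3)[OF R.zero_closed R.zero_closed M.zero_closed M.zero_closed]
          diag(1)[OF _ _ S.zero_closed S.zero_closed] diag(2)[OF R.zero_closed R.zero_closed])
qed

lemma degree_0_form_jordan_derivation:
  assumes \<delta>\<^sub>1: "jordan_derivation R \<delta>\<^sub>1" and \<delta>\<^sub>2: "jordan_derivation S \<delta>\<^sub>2"
    and g: "additive_map M g"
    and upper: "\<And>r m s. \<lbrakk>r \<in> carrier R; m \<in> carrier M; s \<in> carrier S\<rbrakk> \<Longrightarrow>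
      g (r \<odot>\<^bsub>M\<^esub> m \<oplus>\<^bsub>M\<^esub> m \<odot>r\<^bsub>M\<^esub> s) =
        r \<odot>\<^bsub>M\<^esub> g m \<oplus>\<^bsub>M\<^esub> \<delta>\<^sub>1 r \<odot>\<^bsub>M\<^esub> m \<oplus>\<^bsub>M\<^esub> g m \<odot>r\<^bsub>M\<^esub> s \<oplus>\<^bsub>M\<^esub> m \<odot>r\<^bsub>M\<^esub> \<delta>\<^sub>2 s"
    and form: "\<And>r m s. \<lbrakk>r \<in> carrier R; m \<in> carrier M; s \<in> carrier S\<rbrakk> \<Longrightarrow>
      d (Tri r m s) = Tri (\<delta>\<^sub>1 r) (g m) (\<delta>\<^sub>2 s)"
  shows "jordan_derivation T d"
proof -
  have closed: "\<And>r. r \<in> carrier R \<Longrightarrow> \<delta>\<^sub>1 r \<in> carrier R"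
    "\<And>m. m \<in> carrier M \<Longrightarrow> g m \<in> carrier M" "\<And>s. s \<in> carrier S \<Longrightarrow> \<delta>\<^sub>2 s \<in> carrier S"
    using \<delta>\<^sub>1 \<delta>\<^sub>2 g by (auto simp: jordan_derivation_def hom_def)
  have add: "\<And>r r'. \<lbrakk>r \<in> carrier R; r' \<in> carrier R\<rbrakk> \<Longrightarrow> \<delta>\<^sub>1 (r \<oplus>\<^bsub>R\<^esub> r') = \<delta>\<^sub>1 r \<oplus>\<^bsub>R\<^esub> \<delta>\<^sub>1 r'"
    "\<And>m m'. \<lbrakk>m \<in> carrier M; m' \<in> carrier M\<rbrakk> \<Longrightarrow> g (m \<oplus>\<^bsub>M\<^esub> m') = g m \<oplus>\<^bsub>M\<^esub> g m'"
    "\<And>s s'. \<lbrakk>s \<in> carrier S; s' \<in> carrier S\<rbrakk> \<Longrightarrow> \<delta>\<^sub>2 (s \<oplus>\<^bsub>S\<^esub> s') = \<delta>\<^sub>2 s \<oplus>\<^bsub>S\<^esub> \<delta>\<^sub>2 s'"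
    using \<delta>\<^sub>1 \<delta>\<^sub>2 g by (auto simp: jordan_derivation_def hom_def)
  have jordan: "\<And>r r'. \<lbrakk>r \<in> carrier R; r' \<in> carrier R\<rbrakk> \<Longrightarrow>
      \<delta>\<^sub>1 (jordan_prod R r r') = jordan_prod R (\<delta>\<^sub>1 r) r' \<oplus>\<^bsub>R\<^esub> jordan_prod R r (\<delta>\<^sub>1 r')"
    "\<And>s s'. \<lbrakk>s \<in> carrier S; s' \<in> carrier S\<rbrakk> \<Longrightarrow>
      \<delta>\<^sub>2 (jordan_prod S s s') = jordan_prod S (\<delta>\<^sub>2 s) s' \<oplus>\<^bsub>S\<^esub> jordan_prod S s (\<delta>\<^sub>2 s')"
    using \<delta>\<^sub>1 \<delta>\<^sub>2 by (auto simp: jordan_derivation_def)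
  have "d (jordan_prod T x y) = jordan_prod T (d x) y \<oplus>\<^bsub>T\<^esub> jordan_prod T x (d y)"
    if "x \<in> carrier T" "y \<in> carrier T" for x y
  proof -
    obtain r m s r' m' s' where x: "x = Tri r m s" and y: "y = Tri r' m' s'"
      and c: "r \<in> carrier R" "m \<in> carrier M" "s \<in> carrier S"
        "r' \<in> carrier R" "m' \<in> carrier M" "s' \<in> carrier S"
      using \<open>x \<in> carrier T\<close> \<open>y \<in> carrier T\<close> by (elim tri_carrierE)
    (* regroup so that upper applies: r acts on m' together with s, and r' on m with s' *)
    have "(r \<odot>\<^bsub>M\<^esub> m' \<oplus>\<^bsub>M\<^esub> m \<odot>r\<^bsub>M\<^esub> s') \<oplus>\<^bsub>M\<^esub> (r' \<odot>\<^bsub>M\<^esub> m \<oplus>\<^bsub>M\<^esub> m' \<odot>r\<^bsub>M\<^esub> s) =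
        (r \<odot>\<^bsub>M\<^esub> m' \<oplus>\<^bsub>M\<^esub> m' \<odot>r\<^bsub>M\<^esub> s) \<oplus>\<^bsub>M\<^esub> (r' \<odot>\<^bsub>M\<^esub> m \<oplus>\<^bsub>M\<^esub> m \<odot>r\<^bsub>M\<^esub> s')"
      using c by (simp add: smult_simps M.a_ac)
    with c have "g ((r \<odot>\<^bsub>M\<^esub> m' \<oplus>\<^bsub>M\<^esub> m \<odot>r\<^bsub>M\<^esub> s') \<oplus>\<^bsub>M\<^esub> (r' \<odot>\<^bsub>M\<^esub> m \<oplus>\<^bsub>M\<^esub> m' \<odot>r\<^bsub>M\<^esub> s)) =
        g (r \<odot>\<^bsub>M\<^esub> m' \<oplus>\<^bsub>M\<^esub> m' \<odot>r\<^bsub>M\<^esub> s) \<oplus>\<^bsub>M\<^esub> g (r' \<odot>\<^bsub>M\<^esub> m \<oplus>\<^bsub>M\<^esub> m \<odot>r\<^bsub>M\<^esub> s')"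
      using c by (simp add: add smult_simps)
    also have "\<dots> =
        (r \<odot>\<^bsub>M\<^esub> g m' \<oplus>\<^bsub>M\<^esub> \<delta>\<^sub>1 r \<odot>\<^bsub>M\<^esub> m' \<oplus>\<^bsub>M\<^esub> g m' \<odot>r\<^bsub>M\<^esub> s \<oplus>\<^bsub>M\<^esub> m' \<odot>r\<^bsub>M\<^esub> \<delta>\<^sub>2 s) \<oplus>\<^bsub>M\<^esub>
        (r' \<odot>\<^bsub>M\<^esub> g m \<oplus>\<^bsub>M\<^esub> \<delta>\<^sub>1 r' \<odot>\<^bsub>M\<^esub> m \<oplus>\<^bsub>M\<^esub> g m \<odot>r\<^bsub>M\<^esub> s' \<oplus>\<^bsub>M\<^esub> m \<odot>r\<^bsub>M\<^esub> \<delta>\<^sub>2 s')"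
      using c by (simp only: upper)
    also have "\<dots> =
        ((\<delta>\<^sub>1 r \<odot>\<^bsub>M\<^esub> m' \<oplus>\<^bsub>M\<^esub> g m \<odot>r\<^bsub>M\<^esub> s') \<oplus>\<^bsub>M\<^esub> (r' \<odot>\<^bsub>M\<^esub> g m \<oplus>\<^bsub>M\<^esub> m' \<odot>r\<^bsub>M\<^esub> \<delta>\<^sub>2 s)) \<oplus>\<^bsub>M\<^esub>
        ((r \<odot>\<^bsub>M\<^esub> g m' \<oplus>\<^bsub>M\<^esub> m \<odot>r\<^bsub>M\<^esub> \<delta>\<^sub>2 s') \<oplus>\<^bsub>M\<^esub> (\<delta>\<^sub>1 r' \<odot>\<^bsub>M\<^esub> m \<oplus>\<^bsub>M\<^esub> g m' \<odot>r\<^bsub>M\<^esub> s))"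
      using c by (simp add: closed smult_simps M.a_ac)
    finally show ?thesis
      using c by (simp add: x y form closed jordan smult_simps(1,2))
  qed
  then show ?thesis
    by (auto simp: jordan_derivation_def hom_def form closed add elim!: tri_carrierE)
qed

section \<open>Degree 1\<close>

lemma degree_1_form:
  assumes d: "jordan_superderivation_of_degree T G 1 d"
  obtains m' where "m' \<in> carrier M"
    "\<And>r m s. \<lbrakk>r \<in> carrier R; m \<in> carrier M; s \<in> carrier S\<rbrakk> \<Longrightarrow>
      d (Tri r m s) = Tri \<zero>\<^bsub>R\<^esub> (r \<odot>\<^bsub>M\<^esub> m' \<ominus>\<^bsub>M\<^esub> m' \<odot>r\<^bsub>M\<^esub> s) \<zero>\<^bsub>S\<^esub>"
proof -
  have diagonal: "\<exists>n\<in>carrier M. d (Tri r \<zero>\<^bsub>M\<^esub> s) = Tri \<zero>\<^bsub>R\<^esub> n \<zero>\<^bsub>S\<^esub>"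
    if "r \<in> carrier R" "s \<in> carrier S" for r s
    using superderivation_image[OF d, of "Tri r \<zero>\<^bsub>M\<^esub> s" 0] that by (auto elim: oddE)
  obtain m' where m': "m' \<in> carrier M"
    and d_e: "d (Tri \<one>\<^bsub>R\<^esub> \<zero>\<^bsub>M\<^esub> \<zero>\<^bsub>S\<^esub>) = Tri \<zero>\<^bsub>R\<^esub> m' \<zero>\<^bsub>S\<^esub>"
    using diagonal[of "\<one>\<^bsub>R\<^esub>" "\<zero>\<^bsub>S\<^esub>"] by auto
  have d_zero: "d (Tri \<zero>\<^bsub>R\<^esub> \<zero>\<^bsub>M\<^esub> \<zero>\<^bsub>S\<^esub>) = Tri \<zero>\<^bsub>R\<^esub> \<zero>\<^bsub>M\<^esub> \<zero>\<^bsub>S\<^esub>"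
    using superderivation_image[OF d, of "Tri \<zero>\<^bsub>R\<^esub> \<zero>\<^bsub>M\<^esub> \<zero>\<^bsub>S\<^esub>" 0]
      superderivation_image[OF d, of "Tri \<zero>\<^bsub>R\<^esub> \<zero>\<^bsub>M\<^esub> \<zero>\<^bsub>S\<^esub>" 1]
    by (auto elim!: evenE oddE)
  have d_R: "d (Tri r \<zero>\<^bsub>M\<^esub> \<zero>\<^bsub>S\<^esub>) = Tri \<zero>\<^bsub>R\<^esub> (r \<odot>\<^bsub>M\<^esub> m') \<zero>\<^bsub>S\<^esub>" if r: "r \<in> carrier R" for r
  proof -
    obtain n where n: "n \<in> carrier M" and dr: "d (Tri r \<zero>\<^bsub>M\<^esub> \<zero>\<^bsub>S\<^esub>) = Tri \<zero>\<^bsub>R\<^esub> n \<zero>\<^bsub>S\<^esub>"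
      using diagonal[OF r, of "\<zero>\<^bsub>S\<^esub>"] by auto
    have "d (Tri (r \<oplus>\<^bsub>R\<^esub> r) \<zero>\<^bsub>M\<^esub> \<zero>\<^bsub>S\<^esub>) = Tri \<zero>\<^bsub>R\<^esub> (n \<oplus>\<^bsub>M\<^esub> n) \<zero>\<^bsub>S\<^esub>"
      using superderivation_add[OF d, of "Tri r \<zero>\<^bsub>M\<^esub> \<zero>\<^bsub>S\<^esub>" "Tri r \<zero>\<^bsub>M\<^esub> \<zero>\<^bsub>S\<^esub>"] r dr by simp
    moreover have "d (Tri (r \<oplus>\<^bsub>R\<^esub> r) \<zero>\<^bsub>M\<^esub> \<zero>\<^bsub>S\<^esub>) = Tri \<zero>\<^bsub>R\<^esub> (r \<odot>\<^bsub>M\<^esub> m' \<oplus>\<^bsub>M\<^esub> n) \<zero>\<^bsub>S\<^esub>"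
      using jordan_superderivation_even_left[OF d, of "Tri \<one>\<^bsub>R\<^esub> \<zero>\<^bsub>M\<^esub> \<zero>\<^bsub>S\<^esub>" "Tri r \<zero>\<^bsub>M\<^esub> \<zero>\<^bsub>S\<^esub>" 0]
        r n m' dr d_e
      by (simp add: smult_simps R.jordan_prod_one)
    ultimately show ?thesis using dr n m' r by (simp add: smult_simps)
  qed
  have d_S: "d (Tri \<zero>\<^bsub>R\<^esub> \<zero>\<^bsub>M\<^esub> s) = Tri \<zero>\<^bsub>R\<^esub> (\<ominus>\<^bsub>M\<^esub> (m' \<odot>r\<^bsub>M\<^esub> s)) \<zero>\<^bsub>S\<^esub>" if s: "s \<in> carrier S" for s
  proof -
    obtain n where n: "n \<in> carrier M" and ds: "d (Tri \<zero>\<^bsub>R\<^esub> \<zero>\<^bsub>M\<^esub> s) = Tri \<zero>\<^bsub>R\<^esub> n \<zero>\<^bsub>S\<^esub>"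
      using diagonal[OF R.zero_closed s] by auto
    have "m' \<odot>r\<^bsub>M\<^esub> s \<oplus>\<^bsub>M\<^esub> n = \<zero>\<^bsub>M\<^esub>"
      using jordan_superderivation_even_left[OF d, of "Tri \<one>\<^bsub>R\<^esub> \<zero>\<^bsub>M\<^esub> \<zero>\<^bsub>S\<^esub>" "Tri \<zero>\<^bsub>R\<^esub> \<zero>\<^bsub>M\<^esub> s" 0]
        s n m' ds d_e d_zero
      by (simp add: smult_simps)
    then show ?thesis
      using ds n m' s M.minus_equality[of n "m' \<odot>r\<^bsub>M\<^esub> s"] by (simp add: smult_simps M.a_comm)
  qed
  have d_M: "d (Tri \<zero>\<^bsub>R\<^esub> m \<zero>\<^bsub>S\<^esub>) = Tri \<zero>\<^bsub>R\<^esub> \<zero>\<^bsub>M\<^esub> \<zero>\<^bsub>S\<^esub>" if m: "m \<in> carrier M" for m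
  proof -
    obtain a b where a: "a \<in> carrier R" and b: "b \<in> carrier S"
      and dm: "d (Tri \<zero>\<^bsub>R\<^esub> m \<zero>\<^bsub>S\<^esub>) = Tri a \<zero>\<^bsub>M\<^esub> b"
      using superderivation_image[OF d, of "Tri \<zero>\<^bsub>R\<^esub> m \<zero>\<^bsub>S\<^esub>" 1] m by (auto elim: evenE)
    have "Tri a \<zero>\<^bsub>M\<^esub> b = Tri (a \<oplus>\<^bsub>R\<^esub> a) \<zero>\<^bsub>M\<^esub> \<zero>\<^bsub>S\<^esub>"
      using jordan_superderivation_even_left[OF d, of "Tri \<one>\<^bsub>R\<^esub> \<zero>\<^bsub>M\<^esub> \<zero>\<^bsub>S\<^esub>" "Tri \<zero>\<^bsub>R\<^esub> m \<zero>\<^bsub>S\<^esub>" 1]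
        m m' a b dm d_e
      by (simp add: smult_simps R.jordan_prod_one jordan_superprod_upper)
    then show ?thesis using dm a by (simp add: R.add.l_cancel_one')
  qed
  show thesis
  proof (rule that[OF m'])
    show "d (Tri r m s) = Tri \<zero>\<^bsub>R\<^esub> (r \<odot>\<^bsub>M\<^esub> m' \<ominus>\<^bsub>M\<^esub> m' \<odot>r\<^bsub>M\<^esub> s) \<zero>\<^bsub>S\<^esub>"
      if "r \<in> carrier R" "m \<in> carrier M" "s \<in> carrier S" for r m s
      using superderivation_entries[OF d that] that m'
      by (simp add: d_R d_M d_S smult_simps M.minus_eq)
  qed
qed

lemma neg_smult:
  assumes "r \<in> carrier R" "m \<in> carrier M" "s \<in> carrier S"
  shows "r \<odot>\<^bsub>M\<^esub> (\<ominus>\<^bsub>M\<^esub> m) = \<ominus>\<^bsub>M\<^esub> (r \<odot>\<^bsub>M\<^esub> m)" "(\<ominus>\<^bsub>M\<^esub> m) \<odot>r\<^bsub>M\<^esub> s = \<ominus>\<^bsub>M\<^esub> (m \<odot>r\<^bsub>M\<^esub> s)"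
proof -
  have "r \<odot>\<^bsub>M\<^esub> (\<ominus>\<^bsub>M\<^esub> m) \<oplus>\<^bsub>M\<^esub> r \<odot>\<^bsub>M\<^esub> m = \<zero>\<^bsub>M\<^esub>"
    using assms by (simp add: lsmult_r_distr[symmetric] M.l_neg lsmult_zero_right)
  with assms show "r \<odot>\<^bsub>M\<^esub> (\<ominus>\<^bsub>M\<^esub> m) = \<ominus>\<^bsub>M\<^esub> (r \<odot>\<^bsub>M\<^esub> m)"
    using M.minus_equality lsmult_closed M.a_inv_closed by metis
  have "(\<ominus>\<^bsub>M\<^esub> m) \<odot>r\<^bsub>M\<^esub> s \<oplus>\<^bsub>M\<^esub> m \<odot>r\<^bsub>M\<^esub> s = \<zero>\<^bsub>M\<^esub>"
    using assms by (simp add: rsmult_l_distr[symmetric] M.l_neg rsmult_zero_left)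
  with assms show "(\<ominus>\<^bsub>M\<^esub> m) \<odot>r\<^bsub>M\<^esub> s = \<ominus>\<^bsub>M\<^esub> (m \<odot>r\<^bsub>M\<^esub> s)"
    using M.minus_equality rsmult_closed M.a_inv_closed by metis
qed

text \<open>Such a map is the commutator with \<open>Tri 0 m' 0\<close>, an inner derivation.  In the Jordan
  identity the two mixed terms \<open>r m' s'\<close> and \<open>r' m' s\<close> cancel.\<close>

lemma degree_1_form_jordan_derivation:
  assumes m': "m' \<in> carrier M"
    and form: "\<And>r m s. \<lbrakk>r \<in> carrier R; m \<in> carrier M; s \<in> carrier S\<rbrakk> \<Longrightarrow>
      d (Tri r m s) = Tri \<zero>\<^bsub>R\<^esub> (r \<odot>\<^bsub>M\<^esub> m' \<ominus>\<^bsub>M\<^esub> m' \<odot>r\<^bsub>M\<^esub> s) \<zero>\<^bsub>S\<^esub>"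
  shows "jordan_derivation T d"
proof -
  have cancel: "(p \<oplus>\<^bsub>M\<^esub> q) \<ominus>\<^bsub>M\<^esub> (u \<oplus>\<^bsub>M\<^esub> v) =
      ((q \<ominus>\<^bsub>M\<^esub> y) \<oplus>\<^bsub>M\<^esub> (x \<ominus>\<^bsub>M\<^esub> u)) \<oplus>\<^bsub>M\<^esub> ((p \<ominus>\<^bsub>M\<^esub> x) \<oplus>\<^bsub>M\<^esub> (y \<ominus>\<^bsub>M\<^esub> v))"
    if "p \<in> carrier M" "q \<in> carrier M" "u \<in> carrier M" "v \<in> carrier M"
      "x \<in> carrier M" "y \<in> carrier M" for p q u v x y
  proof -
    have "((q \<ominus>\<^bsub>M\<^esub> y) \<oplus>\<^bsub>M\<^esub> (x \<ominus>\<^bsub>M\<^esub> u)) \<oplus>\<^bsub>M\<^esub> ((p \<ominus>\<^bsub>M\<^esub> x) \<oplus>\<^bsub>M\<^esub> (y \<ominus>\<^bsub>M\<^esub> v)) =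
        ((p \<oplus>\<^bsub>M\<^esub> q) \<ominus>\<^bsub>M\<^esub> (u \<oplus>\<^bsub>M\<^esub> v)) \<oplus>\<^bsub>M\<^esub> ((x \<oplus>\<^bsub>M\<^esub> \<ominus>\<^bsub>M\<^esub> x) \<oplus>\<^bsub>M\<^esub> (y \<oplus>\<^bsub>M\<^esub> \<ominus>\<^bsub>M\<^esub> y))"
      using that by (simp only: M.minus_eq M.minus_add M.a_ac M.a_closed M.a_inv_closed)
    then show ?thesis using that by (simp add: M.r_neg)
  qed
  have "d (jordan_prod T x y) = jordan_prod T (d x) y \<oplus>\<^bsub>T\<^esub> jordan_prod T x (d y)"
    if "x \<in> carrier T" "y \<in> carrier T" for x y
  proof -
    obtain r m s r' n s' where x: "x = Tri r m s" and y: "y = Tri r' n s'"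
      and c: "r \<in> carrier R" "m \<in> carrier M" "s \<in> carrier S"
        "r' \<in> carrier R" "n \<in> carrier M" "s' \<in> carrier S"
      using \<open>x \<in> carrier T\<close> \<open>y \<in> carrier T\<close> by (elim tri_carrierE)
    have "jordan_prod R r r' \<odot>\<^bsub>M\<^esub> m' \<ominus>\<^bsub>M\<^esub> m' \<odot>r\<^bsub>M\<^esub> jordan_prod S s s' =
        (r \<odot>\<^bsub>M\<^esub> (r' \<odot>\<^bsub>M\<^esub> m') \<oplus>\<^bsub>M\<^esub> r' \<odot>\<^bsub>M\<^esub> (r \<odot>\<^bsub>M\<^esub> m')) \<ominus>\<^bsub>M\<^esub>
        ((m' \<odot>r\<^bsub>M\<^esub> s) \<odot>r\<^bsub>M\<^esub> s' \<oplus>\<^bsub>M\<^esub> (m' \<odot>r\<^bsub>M\<^esub> s') \<odot>r\<^bsub>M\<^esub> s)"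
      using c m' by (simp add: jordan_prod_def smult_simps)
    also have "\<dots> =
        ((r' \<odot>\<^bsub>M\<^esub> (r \<odot>\<^bsub>M\<^esub> m') \<ominus>\<^bsub>M\<^esub> r' \<odot>\<^bsub>M\<^esub> (m' \<odot>r\<^bsub>M\<^esub> s)) \<oplus>\<^bsub>M\<^esub>
         (r \<odot>\<^bsub>M\<^esub> (m' \<odot>r\<^bsub>M\<^esub> s') \<ominus>\<^bsub>M\<^esub> (m' \<odot>r\<^bsub>M\<^esub> s) \<odot>r\<^bsub>M\<^esub> s')) \<oplus>\<^bsub>M\<^esub>
        ((r \<odot>\<^bsub>M\<^esub> (r' \<odot>\<^bsub>M\<^esub> m') \<ominus>\<^bsub>M\<^esub> r \<odot>\<^bsub>M\<^esub> (m' \<odot>r\<^bsub>M\<^esub> s')) \<oplus>\<^bsub>M\<^esub>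
         (r' \<odot>\<^bsub>M\<^esub> (m' \<odot>r\<^bsub>M\<^esub> s) \<ominus>\<^bsub>M\<^esub> (m' \<odot>r\<^bsub>M\<^esub> s') \<odot>r\<^bsub>M\<^esub> s))"
      by (rule cancel) (use c m' in \<open>simp_all add: smult_simps\<close>)
    finally have "jordan_prod R r r' \<odot>\<^bsub>M\<^esub> m' \<ominus>\<^bsub>M\<^esub> m' \<odot>r\<^bsub>M\<^esub> jordan_prod S s s' = \<dots>" .
    with c m' show ?thesis
      by (simp add: x y form smult_simps neg_smult M.minus_eq M.a_ac)
  qed
  then show ?thesis
    using m' by (auto simp: jordan_derivation_def hom_def form smult_simps M.minus_eq M.minus_add M.a_ac
        elim!: tri_carrierE)
qed

text \<open>The definitions alone do not show this: for two odd elements the degree 1 identity has the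
  sign of \<open>x \<circ> d y\<close> reversed, where \<open>d y\<close> is even, so this product does not vanish by degree.
  The description of degree 1 maps settles it, since they annihilate the odd part.\<close>

lemma jordan_superderivation_jordan_derivation:
  assumes "two_torsion_free R" "two_torsion_free S" "jordan_superderivation T G d"
  shows "jordan_derivation T d"
proof -
  interpret T: ring T by (rule tri_ring_ring)
  obtain d0 d1 where d0: "jordan_superderivation_of_degree T G 0 d0"
    and d1: "jordan_superderivation_of_degree T G 1 d1"
    and sum: "\<And>x. x \<in> carrier T \<Longrightarrow> d x = d0 x \<oplus>\<^bsub>T\<^esub> d1 x"
    using assms(3) unfolding jordan_superderivation_def by blast
  have "jordan_derivation T d0"
    by (rule degree_0_form[OF d0 assms(1,2)]) (rule degree_0_form_jordan_derivation)
  moreover have "jordan_derivation T d1"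
    by (rule degree_1_form[OF d1]) (rule degree_1_form_jordan_derivation)
  ultimately show ?thesis using sum by (rule T.jordan_derivation_sum)
qed

end

section \<open>The structure of Jordan superderivations\<close>

theorem theorem2p3:
  fixes R :: "('r, 'a) ring_scheme" and S :: "('s, 'b) ring_scheme"
    and M :: "('r, 'm, 's, 'c) bimodule_scheme"
    and d\<^sub>0 d\<^sub>1 :: "('r, 'm, 's) tri \<Rightarrow> ('r, 'm, 's) tri"
  assumes "ring R" and "ring S"
    and "two_torsion_free R" and "two_torsion_free S"
    and "bimodule R S M"
    and "jordan_superderivation_of_degree (tri_ring R S M) (tri_grading R S M) 0 d\<^sub>0"
    and "jordan_superderivation_of_degree (tri_ring R S M) (tri_grading R S M) 1 d\<^sub>1"
  shows "(\<exists>\<delta>\<^sub>1 \<delta>\<^sub>2 g m'.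
            jordan_derivation R \<delta>\<^sub>1 \<and> jordan_derivation S \<delta>\<^sub>2 \<and>
            additive_map M g \<and>
            (\<forall>r\<in>carrier R. \<forall>m\<in>carrier M. \<forall>s\<in>carrier S.
               g (r \<odot>\<^bsub>M\<^esub> m \<oplus>\<^bsub>M\<^esub> m \<odot>r\<^bsub>M\<^esub> s) =
                 r \<odot>\<^bsub>M\<^esub> g m \<oplus>\<^bsub>M\<^esub> \<delta>\<^sub>1 r \<odot>\<^bsub>M\<^esub> m \<oplus>\<^bsub>M\<^esub> g m \<odot>r\<^bsub>M\<^esub> s \<oplus>\<^bsub>M\<^esub> m \<odot>r\<^bsub>M\<^esub> \<delta>\<^sub>2 s) \<and>
            m' \<in> carrier M \<and>
            (\<forall>r\<in>carrier R. \<forall>m\<in>carrier M. \<forall>s\<in>carrier S.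
               d\<^sub>0 (Tri r m s) = Tri (\<delta>\<^sub>1 r) (g m) (\<delta>\<^sub>2 s) \<and>
               d\<^sub>1 (Tri r m s) = Tri \<zero>\<^bsub>R\<^esub> (r \<odot>\<^bsub>M\<^esub> m' \<ominus>\<^bsub>M\<^esub> m' \<odot>r\<^bsub>M\<^esub> s) \<zero>\<^bsub>S\<^esub>)) \<and>
         (\<forall>d. jordan_superderivation (tri_ring R S M) (tri_grading R S M) d \<longrightarrow>
              jordan_derivation (tri_ring R S M) d)"
proof -
  interpret bimodule R S M by fact
  show ?thesis
  proof (rule degree_0_form[OF assms(6,3,4)], rule degree_1_form[OF assms(7)])
    fix \<delta>\<^sub>1 \<delta>\<^sub>2 g m'
    assume "jordan_derivation R \<delta>\<^sub>1" "jordan_derivation S \<delta>\<^sub>2" "additive_map M g" "m' \<in> carrier M"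
      and "\<And>r m s. \<lbrakk>r \<in> carrier R; m \<in> carrier M; s \<in> carrier S\<rbrakk> \<Longrightarrow>
        g (r \<odot>\<^bsub>M\<^esub> m \<oplus>\<^bsub>M\<^esub> m \<odot>r\<^bsub>M\<^esub> s) =
          r \<odot>\<^bsub>M\<^esub> g m \<oplus>\<^bsub>M\<^esub> \<delta>\<^sub>1 r \<odot>\<^bsub>M\<^esub> m \<oplus>\<^bsub>M\<^esub> g m \<odot>r\<^bsub>M\<^esub> s \<oplus>\<^bsub>M\<^esub> m \<odot>r\<^bsub>M\<^esub> \<delta>\<^sub>2 s"
      and "\<And>r m s. \<lbrakk>r \<in> carrier R; m \<in> carrier M; s \<in> carrier S\<rbrakk> \<Longrightarrow>
        d\<^sub>0 (Tri r m s) = Tri (\<delta>\<^sub>1 r) (g m) (\<delta>\<^sub>2 s)"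
      and "\<And>r m s. \<lbrakk>r \<in> carrier R; m \<in> carrier M; s \<in> carrier S\<rbrakk> \<Longrightarrow>
        d\<^sub>1 (Tri r m s) = Tri \<zero>\<^bsub>R\<^esub> (r \<odot>\<^bsub>M\<^esub> m' \<ominus>\<^bsub>M\<^esub> m' \<odot>r\<^bsub>M\<^esub> s) \<zero>\<^bsub>S\<^esub>"
    then show ?thesis
      using jordan_superderivation_jordan_derivation[OF assms(3,4)]
      by (intro conjI exI[of _ \<delta>\<^sub>1] exI[of _ \<delta>\<^sub>2] exI[of _ g] exI[of _ m'] ballI allI impI) simp_all
  qed
qed

end
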